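(* Fix an integer $N\ge2$, and let $f:(0,\infty)\to\mathbb{R}$. (a) Suppose $f_\diamond(A)_h\in\mathbb{P}_N$ for all $A\in\mathbb{P}_N((0,\infty))$ and all $h>0$. Then $f\in C^{N-3}((0,\infty))$, and $f^{(k)}(x)\ge0$ for all $x\in(0,\infty)$ and all $0\le k\le N-3$. Moreover, $f^{(k)}$ is convex for each $0\le k\le N-3$, and $f^{(N-3)}$ has nondecreasing left- and right-hand derivatives. (For $N=2$ these conclusions are vacuous.) (b) Suppose $f$ is $2N-2$ times differentiable on $(0,\infty)$, and $f_\diamond(A)\in\mathbb{P}_N$ for all $A\in\mathbb{P}_N((0,\infty))$. Then $f^{(k)}(x)\ge0$ for all $x\in(0,\infty)$ and all $0\le k\le N-1$. Moreover, the assertion of part (b) also holds with $(0,\infty)$ replaced throughout by $(0,\rho)$, for any $0<\rho\le\infty$.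
   Context: Matrices in $\mathbb{C}^{N\times N}$ are indexed by $(i,j)\in\mathcal{K}_{N,N}:=\{0,\dots,N-1\}^2$; put $\mathcal{K}^*_{N,N}:=\mathcal{K}_{N,N}\setminus\{(0,0)\}$. A matrix $A$ with $A^*=A$ is positive semidefinite if $z^*Az\ge 0$ for all $z\in\mathbb{C}^N$. $\mathbb{P}_N(\Omega)$ is the set of $N\times N$ positive semidefinite matrices with entries in $\Omega$, and $\mathbb{P}_N:=\mathbb{P}_N(\mathbb{C})$. For $\ell\ge1$ and $(i,j)\in\mathcal{K}^*_{N,N}$, $\mathcal{P}^*_\ell(i,j)$ is the set of all multisets $S$ of $\ell$ elements (counted with multiplicity) of $\mathcal{K}^*_{N,N}$ with $\sum_{(p,q)\in S}(p,q)=(i,j)$; $c_S(m,n)$ is the multiplicity of $(m,n)$ in $S$. For $h>0$ and $\ell\ge0$, $(D_h^\ell f)(x):=h^{-\ell}\sum_{k=0}^\ell\binom{\ell}{k}(-1)^{\ell-k}f(x+kh)$. For $A=(a_{ij})\in(0,\infty)^{N\times N}$ and $h>0$, the matrix $f_\diamond(A)_h$ is defined by $(f_\diamond(A)_h)_{00}:=f(a_{00})$ and, for $(i,j)\in\mathcal{K}^*_{N,N}$, $$(f_\diamond(A)_h)_{ij}:=\sum_{\ell=1}^{i+j}(D_h^\ell f)(a_{00})\sum_{S\in\mathcal{P}^*_\ell(i,j)}\frac{1}{\prod_{(m,n)\in\mathcal{K}^*_{N,N}}c_S(m,n)!}\prod_{(p,q)\in S}a_{p,q},$$ products over $S$ being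 taken with multiplicity. If $f:J\to\mathbb{R}$ ($J\subseteq\mathbb{R}$ an open interval) is $2N-2$ times differentiable and $A\in J^{N\times N}$, the matrix $f_\diamond(A)$ is defined by the same formulas with $(D_h^\ell f)(a_{00})$ replaced by $f^{(\ell)}(a_{00})$. *)

theory Defs
  imports "HOL-Analysis.Analysis" "Jordan_Normal_Form.Schur_Decomposition"
begin

(* N x N matrices are Jordan_Normal_Form matrices, which are indexed from 0. *)

definition psd_mats :: "nat \<Rightarrow> complex set \<Rightarrow> complex mat set" where
  "psd_mats N \<Omega> = {A \<in> carrier_mat N N.
     mat_adjoint A = A \<and>
     (\<forall>z \<in> carrier_vec N. 0 \<le> (A *\<^sub>v z) \<bullet>c z) \<and>
     (\<forall>i<N. \<forall>j<N. A $$ (i, j) \<in> \<Omega>)}"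
  (* The inner product is z^* A z; in the order on complex numbers, 0 \<le> w says that
     w is real and nonnegative. *)

definition Kstar :: "nat \<Rightarrow> (nat \<times> nat) set" where
  "Kstar N = ({..<N} \<times> {..<N}) - {(0, 0)}"

definition Pstar :: "nat \<Rightarrow> nat \<Rightarrow> nat \<times> nat \<Rightarrow> (nat \<times> nat) multiset set" where
  "Pstar N l ij = {S \<in> multisets_of_size (Kstar N) l. \<Sum>\<^sub># S = ij}"

(* so that sums over Pstar are genuine sums *)
lemma finite_Pstar: "finite (Pstar N l ij)"
  by (simp add: Pstar_def Kstar_def finite_multisets_of_size)

definition fdiff :: "real \<Rightarrow> nat \<Rightarrow> (real \<Rightarrow> real) \<Rightarrow> real \<Rightarrow> real" where
  "fdiff h l f x =
     (\<Sum>k=0..l. of_nat (l choose k) * (-1) ^ (l - k) * f (x + of_nat k * h)) / h ^ l"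

(* The common shape of the two matrix transforms: D l stands for the l-th difference
   quotient, or the l-th derivative, of f. *)
definition diamond ::
  "(nat \<Rightarrow> real \<Rightarrow> real) \<Rightarrow> (real \<Rightarrow> real) \<Rightarrow> nat \<Rightarrow> real mat \<Rightarrow> real mat" where
  "diamond D f N A = mat N N (\<lambda>(i, j).
     if (i, j) = (0, 0) then f (A $$ (0, 0))
     else (\<Sum>l=1..i+j. D l (A $$ (0, 0)) *
       (\<Sum>S\<in>Pstar N l (i, j).
          1 / (\<Prod>mn\<in>Kstar N. fact (count S mn)) * (\<Prod>pq\<in>#S. A $$ pq))))"

definition diamond_h :: "(real \<Rightarrow> real) \<Rightarrow> nat \<Rightarrow> real \<Rightarrow> real mat \<Rightarrow> real mat" where
  "diamond_h f N h A = diamond (\<lambda>l. fdiff h l f) f N A"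

definition diamond_deriv :: "(real \<Rightarrow> real) \<Rightarrow> nat \<Rightarrow> real mat \<Rightarrow> real mat" where
  "diamond_deriv f N A = diamond (\<lambda>l. (deriv ^^ l) f) f N A"

(* The next two are meant for open S only: deriv is the two-sided derivative, so at
   points of S the iterates of deriv depend only on the values of f on S. *)
definition times_differentiable_on :: "nat \<Rightarrow> (real \<Rightarrow> real) \<Rightarrow> real set \<Rightarrow> bool" where
  "times_differentiable_on n f S \<longleftrightarrow>
     (\<forall>k<n. \<forall>x\<in>S. (deriv ^^ k) f differentiable (at x))"

definition C_k_on :: "nat \<Rightarrow> (real \<Rightarrow> real) \<Rightarrow> real set \<Rightarrow> bool" where
  "C_k_on n f S \<longleftrightarrow> times_differentiable_on n f S \<and> continuous_on S ((deriv ^^ n) f)"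

end

theory Submission
  imports Defs
begin

text \<open>If \<open>A\<close> tends to \<open>diag (x, t, 0, \<dots>, 0)\<close> through positive semidefinite matrices with positive
  entries and with \<open>x\<close> kept fixed, the \<open>k\<close>-th diagonal entry of the transform tends to
  \<open>t ^ k / k!\<close> times the \<open>k\<close>-th derivative (or difference quotient) at \<open>x\<close>, which is therefore
  nonnegative for \<open>k < N\<close>. For derivatives this is the claim. For differences, refining the step
  shows that differences with commensurable steps are nonnegative too. Second differences give
  convexity, third differences exclude kinks, and a difference of order \<open>k\<close> of \<open>f'\<close> is a limit of
  differences of order \<open>k + 1\<close> of \<open>f\<close>, so that one can iterate.\<close>


section \<open>Forward differences\<close>

text \<open>Iterates of \<open>fwd h\<close> are the binomial sums in \<open>fdiff\<close> without
  the division by \<open>h ^ l\<close>, which leaves signs unchanged for positive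
  \<open>h\<close>.\<close>

definition fwd :: "real \<Rightarrow> (real \<Rightarrow> real) \<Rightarrow> real \<Rightarrow> real" where
  "fwd h f x = f (x + h) - f x"

definition nonneg_fwd_upto :: "nat \<Rightarrow> (real \<Rightarrow> real) \<Rightarrow> bool" where
  "nonneg_fwd_upto n f \<longleftrightarrow> (\<forall>k\<le>n. \<forall>h>0. \<forall>x>0. 0 \<le> (fwd h ^^ k) f x)"

lemma nonneg_fwd_uptoD:
  "nonneg_fwd_upto n f \<Longrightarrow> k \<le> n \<Longrightarrow> 0 < h \<Longrightarrow> 0 < x \<Longrightarrow> 0 \<le> (fwd h ^^ k) f x"
  by (simp add: nonneg_fwd_upto_def)

lemma fwd_commute: "fwd h (fwd k f) = fwd k (fwd h f)"
  by (auto simp: fwd_def fun_eq_iff algebra_simps)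

lemma fwd_pow_commute: "(fwd h ^^ n) (fwd k f) = fwd k ((fwd h ^^ n) f)"
  by (induction n) (simp_all add: fwd_commute[of h k])

lemma fwd_multiple: "fwd (real m * h) f x = (\<Sum>i<m. fwd h f (x + real i * h))"
proof (induction m)
  case (Suc m)
  have "fwd (real (Suc m) * h) f x = fwd (real m * h) f x + fwd h f (x + real m * h)"
    by (simp add: fwd_def algebra_simps)
  then show ?case using Suc by simp
qed (simp add: fwd_def)

text \<open>By telescoping, a difference with step \<open>real m * h\<close> is a sum of
  \<open>m\<close> translates of the difference with step \<open>h\<close>. Replacing the coarse
  differences one at a time leaves fine differences of order \<open>i + k\<close> at points to the
  right of \<open>a\<close>.\<close>

lemma fwd_pow_multiple_nonneg:
  assumes "\<And>x. x > a \<Longrightarrow> 0 \<le> (fwd h ^^ (i + k)) f x" and "h \<ge> 0" and "x > a"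
  shows "0 \<le> (fwd h ^^ i) ((fwd (real m * h) ^^ k) f) x"
  using assms
proof (induction k arbitrary: f)
  case (Suc k)
  have "0 \<le> (fwd h ^^ (i + k)) (fwd (real m * h) f) y" if "y > a" for y
  proof -
    have "(fwd h ^^ (i + k)) (fwd (real m * h) f) y
        = (\<Sum>j<m. (fwd h ^^ (i + Suc k)) f (y + real j * h))"
      by (simp add: fwd_pow_commute fwd_multiple)
    also have "\<dots> \<ge> 0"
      using Suc.prems(2) that by (intro sum_nonneg Suc.prems(1)) (simp add: add_increasing2 less_le_trans)
    finally show ?thesis .
  qed
  then have "0 \<le> (fwd h ^^ i) ((fwd (real m * h) ^^ k) (fwd (real m * h) f)) x"
    by (intro Suc.IH) (use Suc.prems in auto)
  then show ?case by (simp add: funpow_swap1)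
qed auto

lemma fwd_pow_eq_sum:
  "(fwd h ^^ l) f x = (\<Sum>k\<le>l. of_nat (l choose k) * (-1) ^ (l - k) * f (x + real k * h))"
proof (induction l arbitrary: x)
  case (Suc l)
  let ?g = "\<lambda>k. f (x + real k * h)"
  have A: "(fwd h ^^ l) f (x + h) = (\<Sum>k\<le>l. of_nat (l choose k) * (-1) ^ (l - k) * ?g (Suc k))"
    by (simp add: Suc algebra_simps)
  \<comment> \<open>The added summand at \<open>Suc l\<close> is zero because
    \<open>l choose Suc l = 0\<close>.\<close>
  have B: "(\<Sum>k\<le>l. of_nat (l choose k) * (-1) ^ (l - k) * ?g k)
     = - (\<Sum>k\<le>Suc l. of_nat (l choose k) * (-1) ^ (Suc l - k) * ?g k)"
    by (simp add: sum_negf[symmetric] Suc_diff_le)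
  have "(\<Sum>k\<le>Suc l. of_nat (Suc l choose k) * (-1) ^ (Suc l - k) * ?g k)
     = (-1) ^ Suc l * ?g 0 + (\<Sum>k\<le>l. (real (l choose k) + real (l choose Suc k)) * (-1) ^ (l - k) * ?g (Suc k))"
    by (subst sum.atMost_Suc_shift) simp
  also have "\<dots> = (-1) ^ Suc l * ?g 0
     + (\<Sum>k\<le>l. of_nat (l choose Suc k) * (-1) ^ (l - k) * ?g (Suc k))
     + (\<Sum>k\<le>l. of_nat (l choose k) * (-1) ^ (l - k) * ?g (Suc k))"
    by (simp add: sum.distrib distrib_right)
  also have "(-1) ^ Suc l * ?g 0
     + (\<Sum>k\<le>l. of_nat (l choose Suc k) * (-1) ^ (l - k) * ?g (Suc k))
     = (\<Sum>k\<le>Suc l. of_nat (l choose k) * (-1) ^ (Suc l - k) * ?g k)"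
    by (subst sum.atMost_Suc_shift) simp
  also have "\<dots> = - (fwd h ^^ l) f x"
    using B by (simp only: Suc minus_minus)
  also have "- (fwd h ^^ l) f x + (\<Sum>k\<le>l. of_nat (l choose k) * (-1) ^ (l - k) * ?g (Suc k))
     = (fwd h ^^ Suc l) f x"
    using A by (simp add: fwd_def)
  finally show ?case by simp
qed (simp add: fwd_def)

text \<open>Increments are nondecreasing, so the mean of the first \<open>p\<close> is at most the
  increment at \<open>p\<close>, which is at most the mean of the remaining \<open>m - p\<close>.
  Clearing denominators covers \<open>p = 0\<close> and \<open>p = m\<close>.\<close>

lemma convex_seq_le_chord:
  fixes a :: "nat \<Rightarrow> real"
  assumes "\<And>k. a (Suc k) - a k \<le> a (Suc (Suc k)) - a (Suc k)" and "p \<le> m"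
  shows "real m * a p \<le> real (m - p) * a 0 + real p * a m"
proof -
  define d where "d k = a (Suc k) - a k" for k
  have "incseq d"
    using assms(1) by (intro incseq_SucI) (simp add: d_def)
  have lo: "a p - a 0 \<le> real p * d p"
  proof -
    have "a p - a 0 = (\<Sum>k<p. d k)"
      by (simp add: d_def sum_lessThan_telescope)
    also have "\<dots> \<le> (\<Sum>k<p. d p)"
      by (intro sum_mono) (use \<open>incseq d\<close> in \<open>auto intro: incseqD\<close>)
    finally show ?thesis by simp
  qed
  have hi: "real (m - p) * d p \<le> a m - a p"
  proof -
    have "(\<Sum>k\<in>{p..<m}. d p) \<le> (\<Sum>k\<in>{p..<m}. d k)"
      by (intro sum_mono) (use \<open>incseq d\<close> in \<open>auto intro: incseqD\<close>)
    also have "\<dots> = a m - a p"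
      using assms(2) by (simp add: d_def sum_Suc_diff')
    finally show ?thesis by simp
  qed
  have "real (m - p) * (a p - a 0) \<le> real (m - p) * (real p * d p)"
    using lo by (intro mult_left_mono) auto
  also have "\<dots> = real p * (real (m - p) * d p)" by simp
  also have "\<dots> \<le> real p * (a m - a p)"
    using hi by (intro mult_left_mono) auto
  finally show ?thesis
    using assms(2) by (simp add: of_nat_diff algebra_simps)
qed

lemma nonneg_fwd_upto_mono_on:
  assumes "nonneg_fwd_upto n f" "n \<ge> 1"
  shows "mono_on {0<..} f"
proof (intro mono_onI)
  fix r s :: real assume "r \<in> {0<..}" "s \<in> {0<..}" "r \<le> s"
  then show "f r \<le> f s"
    using nonneg_fwd_uptoD[OF assms(1), of 1 "s - r" r] assms(2)
    by (cases "r = s") (auto simp: fwd_def)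
qed

lemma fwd_sq: "(fwd h ^^ 2) f x = (f (x + 2 * h) - f (x + h)) - (f (x + h) - f x)"
  by (simp add: fwd_def numeral_2_eq_2 algebra_simps)

lemma fwd_cube: "(fwd h ^^ 3) f x = (fwd h ^^ 2) f (x + h) - (fwd h ^^ 2) f x"
  by (simp add: fwd_def numeral_3_eq_3 numeral_2_eq_2)

text \<open>Rational weights only need differences with equal steps; a real weight is approximated from above, which
  monotonicity turns into an upper bound.\<close>

lemma nonneg_fwd_upto_convex_on:
  assumes f: "nonneg_fwd_upto n f" and n: "n \<ge> 2"
  shows "convex_on {0<..} f"
proof (intro convex_on_linorderI)
  fix t x y :: real
  assume t: "0 < t" "t < 1" and xy: "x \<in> {0<..}" "y \<in> {0<..}" "x < y"
  \<comment> \<open>For positive \<open>m\<close> this is \<open>t\<close> rounded up to a multiple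
    of \<open>1 / m\<close>, so that \<open>x + r m * (y - x)\<close> lies on the grid with step
    \<open>(y - x) / m\<close>.\<close>
  define r where "r m = real (nat \<lceil>t * real m\<rceil>) / real m" for m
  have r: "t \<le> r m" "r m \<le> t + 1 / real m" "f (x + r m * (y - x)) \<le> (1 - r m) * f x + r m * f y"
    if "m > 0" for m
  proof -
    have p: "t * real m \<le> real (nat \<lceil>t * real m\<rceil>)" "real (nat \<lceil>t * real m\<rceil>) \<le> t * real m + 1"
      using t by (auto simp: of_nat_nat)
    show "t \<le> r m" "r m \<le> t + 1 / real m"
      using p that by (auto simp: r_def field_simps)
    have le: "nat \<lceil>t * real m\<rceil> \<le> m"
      using t that by (simp add: nat_le_iff ceiling_le_iff mult_left_le_one_le)
    define h where "h = (y - x) / real m"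
    have h: "h > 0" "real m * h = y - x"
      using xy that by (auto simp: h_def)
    have inc: "f (x + real (Suc k) * h) - f (x + real k * h)
       \<le> f (x + real (Suc (Suc k)) * h) - f (x + real (Suc k) * h)" for k
    proof -
      have "0 \<le> (fwd h ^^ 2) f (x + real k * h)"
        using xy h n by (intro nonneg_fwd_uptoD[OF f]) (auto intro!: add_pos_nonneg)
      moreover have "x + real k * h + 2 * h = x + real (Suc (Suc k)) * h"
        "x + real k * h + h = x + real (Suc k) * h"
        by (simp_all add: algebra_simps)
      ultimately show ?thesis by (simp only: fwd_sq)
    qed
    have "real m * f (x + real (nat \<lceil>t * real m\<rceil>) * h)
       \<le> real (m - nat \<lceil>t * real m\<rceil>) * f (x + real 0 * h)
         + real (nat \<lceil>t * real m\<rceil>) * f (x + real m * h)"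
      by (rule convex_seq_le_chord[where a = "\<lambda>k. f (x + real k * h)", OF inc le])
    then show "f (x + r m * (y - x)) \<le> (1 - r m) * f x + r m * f y"
      using that le h by (simp add: r_def h_def of_nat_diff field_simps)
  qed
  have "r \<longlonglongrightarrow> t"
  proof (rule tendsto_sandwich)
    show "eventually (\<lambda>m. t \<le> r m) sequentially" "eventually (\<lambda>m. r m \<le> t + 1 / real m) sequentially"
      using r by (auto intro!: eventually_sequentiallyI[of 1])
    show "(\<lambda>m. t + 1 / real m) \<longlonglongrightarrow> t"
      using tendsto_add[OF tendsto_const lim_1_over_n, of t] by simp
  qed auto
  then have "(\<lambda>m. (1 - r m) * f x + r m * f y) \<longlonglongrightarrow> (1 - t) * f x + t * f y"
    by (intro tendsto_intros)
  moreover have "eventually (\<lambda>m. f (x + t * (y - x)) \<le> (1 - r m) * f x + r m * f y) sequentially"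
    using eventually_gt_at_top[of 0]
  proof eventually_elim
    case (elim m)
    have "f (x + t * (y - x)) \<le> f (x + r m * (y - x))"
      using r(1)[OF elim] xy t
      by (intro mono_onD[OF nonneg_fwd_upto_mono_on[OF f]]) (use n in \<open>auto intro!: add_pos_nonneg mult_right_mono\<close>)
    then show ?case using r(3)[OF elim] by linarith
  qed
  ultimately have "f (x + t * (y - x)) \<le> (1 - t) * f x + t * f y"
    by (intro tendsto_lowerbound) auto
  then show "f ((1 - t) *\<^sub>R x + t *\<^sub>R y) \<le> (1 - t) * f x + t * f y"
    by (simp add: algebra_simps)
qed auto

section \<open>One-sided derivatives of convex functions\<close>

definition slope :: "(real \<Rightarrow> real) \<Rightarrow> real \<Rightarrow> real \<Rightarrow> real" where
  "slope f x y = (f y - f x) / (y - x)"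

lemma slope_commute: "slope f x y = slope f y x"
  unfolding slope_def by (metis minus_diff_eq minus_divide_divide)

text \<open>The three-chord inequality, with the base point \<open>x\<close> to the left of, to the
  right of, or between the other two points; the last case compares slopes on opposite sides of
  \<open>x\<close>.\<close>

lemma slope_mono:
  assumes f: "convex_on S f" and S: "x \<in> S" "y \<in> S" "z \<in> S" and "y \<noteq> x" "z \<noteq> x" "y \<le> z"
  shows "slope f x y \<le> slope f x z"
proof -
  consider "y = z" | "x < y" "y < z" | "y < z" "z < x" | "y < x" "x < z"
    using assms by linarith
  then show ?thesis
  proof cases
    case 2
    then show ?thesis
      using convex_on_slope_le(1)[OF f S(1,3), of y] by (simp add: slope_def[symmetric] slope_commute)
  next
    case 3
    then show ?thesis
      using convex_on_slope_le(2)[OF f S(2,1), of z] by (simp add: slope_def[symmetric] slope_commute)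
  next
    case 4
    then show ?thesis
      using convex_on_slope_le[OF f S(2,3), of x] by (simp add: slope_def[symmetric] slope_commute)
  qed simp
qed

definition right_deriv :: "(real \<Rightarrow> real) \<Rightarrow> real \<Rightarrow> real" where
  "right_deriv f x = Inf (slope f x ` {x<..})"

text \<open>The parameter \<open>a\<close> is the left end of the domain: it keeps points where
  nothing is known about \<open>f\<close> out of the supremum. On the right the domain is
  unbounded.\<close>

definition left_deriv :: "real \<Rightarrow> (real \<Rightarrow> real) \<Rightarrow> real \<Rightarrow> real" where
  "left_deriv a f x = Sup (slope f x ` {a<..<x})"

context
  fixes a :: real and f :: "real \<Rightarrow> real"
  assumes convex: "convex_on {a<..} f"
begin

lemma right_deriv_le_slope:
  assumes "a < x" "x < y" shows "right_deriv f x \<le> slope f x y"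
  unfolding right_deriv_def
proof (rule cInf_lower)
  \<comment> \<open>The slope to a point on the other side of \<open>x\<close>, here the midpoint of
    \<open>a\<close> and \<open>x\<close>, is a lower bound.\<close>
  show "bdd_below (slope f x ` {x<..})"
    using assms by (intro bdd_belowI[of _ "slope f x ((a + x) / 2)"]) (auto intro!: slope_mono[OF convex])
qed (use assms in auto)

lemma slope_le_left_deriv:
  assumes "a < y" "y < x" shows "slope f x y \<le> left_deriv a f x"
  unfolding left_deriv_def
proof (rule cSup_upper)
  show "bdd_above (slope f x ` {a<..<x})"
    using assms by (intro bdd_aboveI[of _ "slope f x (x + 1)"]) (auto intro!: slope_mono[OF convex])
qed (use assms in auto)

lemma left_deriv_le_slope:
  assumes "a < x" "x < y" shows "left_deriv a f x \<le> slope f x y"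
  unfolding left_deriv_def
  using assms dense[of a x] by (intro cSup_least) (auto intro!: slope_mono[OF convex])

lemma slope_le_right_deriv:
  assumes "a < y" "y < x" shows "slope f x y \<le> right_deriv f x"
  unfolding right_deriv_def
  using assms by (intro cInf_greatest) (auto intro!: slope_mono[OF convex])

text \<open>Slopes decrease to their infimum: once the slope to some \<open>z\<close> is below
  \<open>c\<close>, so are those to all points between \<open>x\<close> and
  \<open>z\<close>.\<close>

lemma has_right_deriv:
  assumes "a < x" shows "(f has_real_derivative right_deriv f x) (at_right x)"
  unfolding has_field_derivative_iff slope_def[symmetric]
proof (rule decreasing_tendsto)
  show "\<forall>\<^sub>F y in at_right x. right_deriv f x \<le> slope f x y"
    using right_deriv_le_slope[OF assms] by (auto simp: eventually_at_right_field intro!: gt_ex)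
next
  fix c assume "right_deriv f x < c"
  then obtain z where z: "x < z" "slope f x z < c"
    unfolding right_deriv_def
    by (subst (asm) cInf_less_iff)
       (use assms in \<open>auto intro!: bdd_belowI[of _ "slope f x ((a + x) / 2)"] slope_mono[OF convex]\<close>)
  have "slope f x y < c" if "x < y" "y < z" for y
    using slope_mono[OF convex, of x y z] assms z that by auto
  then show "\<forall>\<^sub>F y in at_right x. slope f x y < c"
    using z(1) by (auto simp: eventually_at_right_field)
qed

lemma has_left_deriv:
  assumes "a < x" shows "(f has_real_derivative left_deriv a f x) (at_left x)"
  unfolding has_field_derivative_iff slope_def[symmetric]
proof (rule increasing_tendsto)
  show "\<forall>\<^sub>F y in at_left x. slope f x y \<le> left_deriv a f x"
    using slope_le_left_deriv assms by (auto simp: eventually_at_left_field)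
next
  fix c assume "c < left_deriv a f x"
  then obtain z where z: "a < z" "z < x" "c < slope f x z"
    unfolding left_deriv_def
    by (subst (asm) less_cSup_iff)
       (use assms in \<open>auto intro!: bdd_aboveI[of _ "slope f x (x + 1)"] slope_mono[OF convex]\<close>)
  have "c < slope f x y" if "z < y" "y < x" for y
    using slope_mono[OF convex, of x z y] assms z that by auto
  then show "\<forall>\<^sub>F y in at_left x. c < slope f x y"
    using z(2) by (auto simp: eventually_at_left_field)
qed

text \<open>The slope of the chord joining \<open>r\<close> and \<open>s\<close> separates the two
  values.\<close>

lemma mono_on_right_deriv: "mono_on {a<..} (right_deriv f)"
proof (intro mono_onI)
  fix r s assume "r \<in> {a<..}" "s \<in> {a<..}" "r \<le> s"
  then show "right_deriv f r \<le> right_deriv f s"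
    using right_deriv_le_slope[of r s] slope_le_right_deriv[of r s] slope_commute[of f r s]
    by (cases "r = s") auto
qed

lemma mono_on_left_deriv: "mono_on {a<..} (left_deriv a f)"
proof (intro mono_onI)
  fix r s assume "r \<in> {a<..}" "s \<in> {a<..}" "r \<le> s"
  then show "left_deriv a f r \<le> left_deriv a f s"
    using left_deriv_le_slope[of r s] slope_le_left_deriv[of r s] slope_commute[of f r s]
    by (cases "r = s") auto
qed

lemma left_deriv_le_right_deriv:
  assumes "a < x" shows "left_deriv a f x \<le> right_deriv f x"
  unfolding right_deriv_def
  using assms left_deriv_le_slope by (intro cInf_greatest) auto

end

section \<open>Differentiability from nonnegative differences\<close>

text \<open>A kink at \<open>x\<close> gives second differences of size at least \<open>c * h\<close> there, with \<open>c > 0\<close>; nonnegative third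
  differences carry this bound along the progression \<open>x, x + h, \<dots>, x + 1\<close>, and the sum
  contradicts continuity at \<open>x + 1\<close>.\<close>

lemma nonneg_fwd_upto_has_derivative:
  assumes f: "nonneg_fwd_upto n f" and n: "n \<ge> 3" and x: "x > 0"
  shows "(f has_real_derivative right_deriv f x) (at x)"
proof -
  have convex: "convex_on {0<..} f"
    using nonneg_fwd_upto_convex_on[OF f] n by simp
  have "left_deriv 0 f x = right_deriv f x"
  proof (rule ccontr)
    assume "left_deriv 0 f x \<noteq> right_deriv f x"
    then obtain c where c: "c > 0" "right_deriv f x - left_deriv 0 f x = c"
      using left_deriv_le_right_deriv[OF convex x] by force
    have gap: "c \<le> f (x + 1) - f (x + 1 - 1 / real m)" if m: "m > 0" "1 / real m < x" for m
    proof -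
      define h where "h = 1 / real m"
      have h: "h > 0" "h < x" "real m * h = 1" using m by (auto simp: h_def)
      \<comment> \<open>The second difference starting at \<open>x - h\<close> is centred at the
        kink; it is \<open>h\<close> times a difference of slopes that is at least the jump
        \<open>c\<close>.\<close>
      have "h * c \<le> h * (slope f x (x + h) - slope f x (x - h))"
        using right_deriv_le_slope[OF convex x, of "x + h"]
          slope_le_left_deriv[OF convex, of "x - h" x] h c
        by (intro mult_left_mono) auto
      also have "\<dots> = (fwd h ^^ 2) f (x - h)"
        using h by (simp add: slope_def fwd_sq field_simps)
      finally have base: "h * c \<le> (fwd h ^^ 2) f (x - h)" .
      have step: "h * c \<le> (fwd h ^^ 2) f (x - h + real j * h)" for j
      proof (induction j)
        case (Suc j)
        have "0 \<le> (fwd h ^^ 3) f (x - h + real j * h)"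
          using h n by (intro nonneg_fwd_uptoD[OF f]) (auto intro!: add_pos_nonneg)
        then show ?case using Suc by (simp add: fwd_cube algebra_simps)
      qed (use base in simp)
      have "c = (\<Sum>j<m. h * c)" using h by (simp add: mult.assoc[symmetric])
      also have "\<dots> \<le> (\<Sum>j<m. (fwd h ^^ 2) f (x - h + real j * h))"
        by (intro sum_mono step)
      also have "\<dots> = (\<Sum>j<m. fwd h (fwd h f) (x - h + real j * h))"
        by (simp add: numeral_2_eq_2)
      \<comment> \<open>The second differences telescope over total length 1, leaving first
        differences at the two ends; the left one is dropped because \<open>f\<close> is
        nondecreasing.\<close>
      also have "\<dots> = fwd (real m * h) (fwd h f) (x - h)"
        by (rule fwd_multiple[symmetric])
      also have "\<dots> = fwd h f (x + 1 - h) - fwd h f (x - h)"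
        using h by (simp add: fwd_def algebra_simps)
      also have "\<dots> \<le> fwd h f (x + 1 - h)"
        using nonneg_fwd_uptoD[OF f, of 1 h "x - h"] h n by simp
      finally show ?thesis by (simp add: fwd_def h_def)
    qed
    have "continuous (at (x + 1)) f"
      using convex_on_continuous[OF _ convex] x by (simp add: continuous_on_eq_continuous_at)
    moreover have "(\<lambda>m. x + 1 - 1 / real m) \<longlonglongrightarrow> x + 1"
      using tendsto_diff[OF tendsto_const lim_1_over_n, of "x + 1"] by simp
    ultimately have "(\<lambda>m. f (x + 1 - 1 / real m)) \<longlonglongrightarrow> f (x + 1)"
      by (rule isCont_tendsto_compose)
    then have "(\<lambda>m. f (x + 1) - f (x + 1 - 1 / real m)) \<longlonglongrightarrow> f (x + 1) - f (x + 1)"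
      by (intro tendsto_intros)
    moreover have "eventually (\<lambda>m. c \<le> f (x + 1) - f (x + 1 - 1 / real m)) sequentially"
      using eventually_gt_at_top[of 0] order_tendstoD(2)[OF lim_1_over_n x]
      by eventually_elim (use gap in blast)
    ultimately have "c \<le> f (x + 1) - f (x + 1)"
      by (intro tendsto_lowerbound) auto
    then show False using c by simp
  qed
  then show ?thesis
    using has_left_deriv[OF convex x] has_right_deriv[OF convex x]
    by (simp add: has_field_derivative_iff filterlim_at_split)
qed

section \<open>Inheritance of nonnegative differences by derivatives\<close>

lemma has_derivative_fwd_pow:
  assumes "\<And>x. x > 0 \<Longrightarrow> (f has_real_derivative g x) (at x)" and "h > 0" "x > 0"
  shows "((fwd h ^^ k) f has_real_derivative (fwd h ^^ k) g x) (at x)"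
  using assms(3)
proof (induction k arbitrary: x)
  case (Suc k)
  have "((\<lambda>x. (fwd h ^^ k) f (x + h)) has_real_derivative (fwd h ^^ k) g (x + h)) (at x)"
    using Suc.IH[of "x + h"] Suc.prems assms(2) by (simp add: DERIV_shift)
  from DERIV_diff[OF this Suc.IH[OF Suc.prems]] show ?case
    by (simp add: fwd_def[abs_def])
qed (use assms in auto)

text \<open>A \<open>k\<close>-th difference of \<open>deriv f\<close> is the derivative of the
  \<open>k\<close>-th difference of \<open>f\<close>. Increments \<open>h / real m\<close> make its
  quotients mixed differences of order \<open>k + 1\<close> with commensurable steps, hence
  nonnegative.\<close>

lemma nonneg_fwd_upto_deriv:
  assumes f: "nonneg_fwd_upto (Suc n) f" and n: "n \<ge> 2"
  shows "nonneg_fwd_upto n (deriv f)"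
  unfolding nonneg_fwd_upto_def
proof (intro allI impI)
  fix k h x assume k: "k \<le> n" and h: "(0::real) < h" and x: "(0::real) < x"
  have "(f has_real_derivative deriv f y) (at y)" if "y > 0" for y
    using nonneg_fwd_upto_has_derivative[OF f _ that] n
    by (metis DERIV_imp_deriv Suc_le_mono numeral_2_eq_2 numeral_3_eq_3)
  then have "((fwd h ^^ k) f has_real_derivative (fwd h ^^ k) (deriv f) x) (at x)"
    using h x by (intro has_derivative_fwd_pow)
  then have "((\<lambda>t. ((fwd h ^^ k) f (x + t) - (fwd h ^^ k) f x) / t) \<longlongrightarrow> (fwd h ^^ k) (deriv f) x) (at 0)"
    by (simp add: DERIV_def)
  moreover have "filterlim (\<lambda>m. h / real m) (at 0) sequentially"
    using h tendsto_mult[OF tendsto_const lim_1_over_n, of h]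
    by (auto simp: filterlim_at intro!: eventually_sequentiallyI[of 1])
  ultimately have "(\<lambda>m. ((fwd h ^^ k) f (x + h / real m) - (fwd h ^^ k) f x) / (h / real m))
     \<longlonglongrightarrow> (fwd h ^^ k) (deriv f) x"
    by (rule filterlim_compose)
  moreover have "\<forall>\<^sub>F m in sequentially.
      0 \<le> ((fwd h ^^ k) f (x + h / real m) - (fwd h ^^ k) f x) / (h / real m)"
    using eventually_gt_at_top[of 0]
  proof eventually_elim
    case (elim m)
    have "0 \<le> (fwd (h / real m) ^^ 1) ((fwd (real m * (h / real m)) ^^ k) f) x"
      by (rule fwd_pow_multiple_nonneg[of 0])
        (use nonneg_fwd_uptoD[OF f, of "1 + k" "h / real m"] k h x elim in auto)
    then show ?case using elim h by (simp add: fwd_def)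
  qed
  ultimately show "0 \<le> (fwd h ^^ k) (deriv f) x"
    by (intro tendsto_lowerbound) auto
qed

text \<open>The bound on \<open>k\<close> ensures order at least 3 before each differentiation and
  at least 2 after the last one, so the final derivative is still convex.\<close>

lemma nonneg_fwd_upto_higher_deriv:
  assumes "nonneg_fwd_upto n f" "k + 2 \<le> n"
  shows "nonneg_fwd_upto (n - k) ((deriv ^^ k) f)"
  using assms(2)
proof (induction k)
  case (Suc k)
  then have "nonneg_fwd_upto (n - Suc k) (deriv ((deriv ^^ k) f))"
    by (intro nonneg_fwd_upto_deriv) (simp_all add: Suc_diff_Suc)
  then show ?case by simp
qed (use assms in simp)

section \<open>Diagonal entries of the transforms\<close>

definition ridge_mat :: "nat \<Rightarrow> (nat \<Rightarrow> real) \<Rightarrow> real \<Rightarrow> real mat" where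
  "ridge_mat N d e = mat N N (\<lambda>(i, j). e + (if i = j then d i else 0))"

lemma quadratic_form_eq_sum:
  assumes "A \<in> carrier_mat N N" "z \<in> carrier_vec N"
  shows "(A *\<^sub>v z) \<bullet>c z = (\<Sum>i<N. \<Sum>j<N. A $$ (i, j) * vec_index z j * cnj (vec_index z i))"
  using assms
  by (auto simp: scalar_prod_def atLeast0LessThan sum_distrib_right intro!: sum.cong)

text \<open>The all-ones part contributes \<open>e\<close> times the squared modulus of the sum of
  the coordinates, the diagonal part a weighted sum of squared moduli.\<close>

lemma ridge_mat_psd:
  assumes "e \<ge> 0" "\<And>i. i < N \<Longrightarrow> d i \<ge> 0"
    and "\<And>i. i < N \<Longrightarrow> e + d i \<in> J" "e \<in> J"
  shows "map_mat complex_of_real (ridge_mat N d e) \<in> psd_mats N (complex_of_real ` J)"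
  unfolding psd_mats_def
proof (intro CollectI conjI ballI allI impI)
  let ?A = "map_mat complex_of_real (ridge_mat N d e)"
  show A: "?A \<in> carrier_mat N N" by (simp add: ridge_mat_def)
  show "mat_adjoint ?A = ?A"
    by (rule eq_matI) (auto simp: mat_adjoint_def ridge_mat_def mat_of_rows_index)
  show "?A $$ (i, j) \<in> complex_of_real ` J" if "i < N" "j < N" for i j
    using assms(3)[OF that(1)] assms(4) that
    by (auto simp: ridge_mat_def simp flip: of_real_add)
  fix z :: "complex vec" assume z: "z \<in> carrier_vec N"
  have "(?A *\<^sub>v z) \<bullet>c z
     = (\<Sum>i<N. \<Sum>j<N. of_real e * vec_index z j * cnj (vec_index z i)
         + (if i = j then of_real (d i) * (vec_index z i * cnj (vec_index z i)) else 0))"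
    unfolding quadratic_form_eq_sum[OF A z]
    by (intro sum.cong) (auto simp: ridge_mat_def algebra_simps)
  also have "\<dots> = of_real e * (cnj (\<Sum>i<N. vec_index z i) * (\<Sum>j<N. vec_index z j))
     + (\<Sum>i<N. of_real (d i) * (vec_index z i * cnj (vec_index z i)))"
    by (simp only: sum.distrib cnj_sum sum_product sum_distrib_left mult_ac) simp
  also have "\<dots> = of_real (e * (cmod (\<Sum>j<N. vec_index z j))\<^sup>2 + (\<Sum>i<N. d i * (cmod (vec_index z i))\<^sup>2))"
    by (simp only: of_real_add of_real_mult of_real_sum complex_norm_square mult.commute[of "cnj _"])
  also have "0 \<le> \<dots>"
    using assms by (auto simp: less_eq_complex_def intro!: add_nonneg_nonneg sum_nonneg)
  finally show "0 \<le> (?A *\<^sub>v z) \<bullet>c z" .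
qed

lemma psd_diag_nonneg:
  assumes "map_mat complex_of_real A \<in> psd_mats N \<Omega>" "k < N"
  shows "0 \<le> A $$ (k, k)"
proof -
  let ?A = "map_mat complex_of_real A" and ?e = "unit_vec N k :: complex vec"
  have A: "?A \<in> carrier_mat N N" using assms by (simp add: psd_mats_def)
  have "0 \<le> (?A *\<^sub>v ?e) \<bullet>c ?e"
    using assms by (simp add: psd_mats_def)
  also have "\<dots> = (\<Sum>i<N. \<Sum>j<N. if i = k \<and> j = k then ?A $$ (k, k) else 0)"
    unfolding quadratic_form_eq_sum[OF A unit_vec_carrier]
    by (intro sum.cong) (auto simp: unit_vec_def)
  also have "\<dots> = (\<Sum>i<N. if i = k then ?A $$ (k, k) else 0)"
    using assms(2) by (intro sum.cong) auto
  also have "\<dots> = of_real (A $$ (k, k))"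
    using assms(2) A by simp
  finally show ?thesis by (simp add: less_eq_complex_def)
qed

section \<open>Limits of the diagonal entries\<close>

lemma tendsto_prod_mset:
  fixes g :: "'b \<Rightarrow> 'a \<Rightarrow> 'c :: {comm_monoid_mult, topological_semigroup_mult}"
  assumes "\<And>p. p \<in># S \<Longrightarrow> (g p \<longlongrightarrow> c p) F"
  shows "((\<lambda>e. \<Prod>p\<in>#S. g p e) \<longlongrightarrow> (\<Prod>p\<in>#S. c p)) F"
  using assms by (induction S) (auto intro!: tendsto_mult)

lemma sum_mset_replicate_pair:
  "\<Sum>\<^sub># (replicate_mset l (a, b)) = (l * a, l * (b::nat))" for a :: nat
  by (induction l) (simp_all add: zero_prod_def)

text \<open>The entry is the coefficient of \<open>(X * Y) ^ k\<close> in \<open>f (x + t * X * Y)\<close>: only the multiset of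
  \<open>k\<close> copies of \<open>(1, 1)\<close> contributes.\<close>

lemma diamond_entry_single:
  fixes t :: real and D :: "nat \<Rightarrow> real"
  assumes "N \<ge> 2" "k < N" "k \<ge> 1"
  defines "c \<equiv> \<lambda>p. if p = (1, 1) then t else 0"
  shows "(\<Sum>l=1..k+k. D l * (\<Sum>S\<in>Pstar N l (k, k).
      1 / (\<Prod>mn\<in>Kstar N. fact (count S mn)) * (\<Prod>pq\<in>#S. c pq)))
    = D k * (t ^ k / fact k)"
proof -
  define w where "w S = 1 / (\<Prod>mn\<in>Kstar N. fact (count S mn)) * (\<Prod>pq\<in>#S. c pq)"
    for S :: "(nat \<times> nat) multiset"
  have in_K: "(1, 1) \<in> Kstar N" using assms by (auto simp: Kstar_def)
  have w0: "w S = 0" if "S \<in> Pstar N l (k, k)" "\<not> (l = k \<and> S = replicate_mset k (1, 1))" for l S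
  proof -
    \<comment> \<open>If all elements were \<open>(1, 1)\<close>, size and sum would force the
      excluded multiset; any other element makes the product vanish.\<close>
    have "\<exists>p\<in>#S. p \<noteq> (1, 1)"
    proof (rule ccontr)
      assume "\<not> ?thesis"
      then have "S = replicate_mset (size S) (1, 1)"
        by (metis set_mset_subset_singletonD subsetI singleton_iff)
      moreover have "size S = l" "\<Sum>\<^sub># S = (k, k)"
        using that by (auto simp: Pstar_def multisets_of_size_def)
      ultimately show False
        using that sum_mset_replicate_pair[of l 1 1] by auto
    qed
    then show ?thesis by (auto simp: w_def c_def prod_mset_zero_iff)
  qed
  have wk: "w (replicate_mset k (1, 1)) = t ^ k / fact k"
  proof -
    have "(\<Prod>mn\<in>Kstar N. fact (count (replicate_mset k (1, 1)) mn) :: real)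
       = (\<Prod>mn\<in>Kstar N. if mn = (1, 1) then fact k else 1)"
      by (intro prod.cong) auto
    also have "\<dots> = fact k"
      using in_K by (simp add: Kstar_def)
    finally show ?thesis by (simp add: w_def c_def)
  qed
  have mem: "replicate_mset k (1, 1) \<in> Pstar N k (k, k)"
    using in_K sum_mset_replicate_pair[of k 1 1] by (auto simp: Pstar_def multisets_of_size_def)
  have "(\<Sum>l=1..k+k. D l * (\<Sum>S\<in>Pstar N l (k, k). w S))
      = (\<Sum>l\<in>{k}. D l * (\<Sum>S\<in>Pstar N l (k, k). w S))"
    using assms(3) w0 by (intro sum.mono_neutral_right) (auto intro!: sum.neutral)
  also have "(\<Sum>S\<in>Pstar N k (k, k). w S) = (\<Sum>S\<in>{replicate_mset k (1, 1)}. w S)"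
    using w0 mem by (intro sum.mono_neutral_right) (auto simp: finite_Pstar)
  then have "(\<Sum>l\<in>{k}. D l * (\<Sum>S\<in>Pstar N l (k, k). w S)) = D k * (t ^ k / fact k)"
    using wk by simp
  finally show ?thesis by (simp add: w_def)
qed

text \<open>Test matrices: \<open>diag (x, x/2, 0, \<dots>, 0)\<close>, made entrywise positive by a perturbation of size
  \<open>e\<close> that keeps the entry at \<open>(0, 0)\<close>, hence all values \<open>D l x\<close>, fixed.\<close>

lemma diamond_psd_imp_nonneg:
  assumes N: "N \<ge> 2" and k: "k < N" and x: "x > 0" and D0: "D 0 x = f x"
    and J: "{0<..x} \<subseteq> J"
    and psd: "\<And>A. map_mat complex_of_real A \<in> psd_mats N (complex_of_real ` J) \<Longrightarrow>
      map_mat complex_of_real (diamond D f N A) \<in> psd_mats N UNIV"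
  shows "0 \<le> D k x"
proof -
  define A where "A e = ridge_mat N (\<lambda>i. if i = 0 then x - e else if i = 1 then x / 2 else 0) e" for e
  \<comment> \<open>For \<open>e < x / 2\<close> no entry exceeds \<open>x\<close>, the one at
    \<open>(1, 1)\<close> being \<open>e + x / 2\<close>; this admits intervals \<open>J\<close>
    bounded above.\<close>
  have A_psd: "map_mat complex_of_real (A e) \<in> psd_mats N (complex_of_real ` J)"
    if "0 < e" "e < x / 2" for e
    unfolding A_def using that x J by (intro ridge_mat_psd) auto
  have nonneg: "0 \<le> diamond D f N (A e) $$ (k, k)" if "0 < e" "e < x / 2" for e
    using psd_diag_nonneg[OF psd[OF A_psd[OF that]] k] .
  have A00: "A e $$ (0, 0) = x" for e using N by (simp add: A_def ridge_mat_def)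
  show ?thesis
  proof (cases "k = 0")
    case True
    then show ?thesis
      using nonneg[of "x / 4"] x N D0 A00 by (simp add: diamond_def)
  next
    case False
    define c :: "nat \<times> nat \<Rightarrow> real" where "c = (\<lambda>p. if p = (1, 1) then x / 2 else 0)"
    have lim: "((\<lambda>e. A e $$ p) \<longlongrightarrow> c p) (at_right 0)" if "p \<in> Kstar N" for p
    proof -
      \<comment> \<open>Exact because \<open>Kstar\<close> omits \<open>(0, 0)\<close>, the only
        index where the diagonal correction depends on \<open>e\<close>.\<close>
      have eq: "A e $$ p = e + c p" for e
        using that by (cases p) (auto simp: A_def ridge_mat_def c_def Kstar_def)
      have "((\<lambda>e. e + c p) \<longlongrightarrow> 0 + c p) (at_right 0)"
        by (intro tendsto_intros)
      then show ?thesis by (simp add: eq)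
    qed
    have "((\<lambda>e. \<Sum>l=1..k+k. D l x * (\<Sum>S\<in>Pstar N l (k, k).
        1 / (\<Prod>mn\<in>Kstar N. fact (count S mn)) * (\<Prod>pq\<in>#S. A e $$ pq)))
      \<longlongrightarrow> (\<Sum>l=1..k+k. D l x * (\<Sum>S\<in>Pstar N l (k, k).
        1 / (\<Prod>mn\<in>Kstar N. fact (count S mn)) * (\<Prod>pq\<in>#S. c pq)))) (at_right 0)"
      by (intro tendsto_sum tendsto_mult tendsto_const tendsto_prod_mset lim)
        (auto simp: Pstar_def multisets_of_size_def)
    also have "(\<Sum>l=1..k+k. D l x * (\<Sum>S\<in>Pstar N l (k, k).
        1 / (\<Prod>mn\<in>Kstar N. fact (count S mn)) * (\<Prod>pq\<in>#S. c pq))) = D k x * ((x / 2) ^ k / fact k)"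
      unfolding c_def using N k False by (intro diamond_entry_single) auto
    also have "(\<lambda>e. \<Sum>l=1..k+k. D l x * (\<Sum>S\<in>Pstar N l (k, k).
        1 / (\<Prod>mn\<in>Kstar N. fact (count S mn)) * (\<Prod>pq\<in>#S. A e $$ pq)))
      = (\<lambda>e. diamond D f N (A e) $$ (k, k))"
      using False k by (simp add: diamond_def A00)
    finally have "0 \<le> D k x * ((x / 2) ^ k / fact k)"
    proof (rule tendsto_lowerbound)
      show "\<forall>\<^sub>F e in at_right 0. 0 \<le> diamond D f N (A e) $$ (k, k)"
        using nonneg x by (auto simp: eventually_at_right_field intro!: exI[of _ "x / 2"])
    qed simp
    moreover have "0 < (x / 2) ^ k / fact k" using x by simp
    ultimately show ?thesis by (simp only: zero_le_mult_iff) linarith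
  qed
qed

lemma fdiff_eq_fwd: "fdiff h l f x = (fwd h ^^ l) f x / h ^ l"
  by (simp add: fdiff_def fwd_pow_eq_sum atMost_atLeast0)

section \<open>Consequences for difference quotients and for derivatives\<close>

theorem theorem4:
  fixes N :: nat and f :: "real \<Rightarrow> real"
  assumes "N \<ge> 2"
  shows
    "((\<forall>A :: real mat. \<forall>h>0.
         map_mat complex_of_real A \<in> psd_mats N (complex_of_real ` {0<..}) \<longrightarrow>
         map_mat complex_of_real (diamond_h f N h A) \<in> psd_mats N UNIV)
      \<longrightarrow> N \<ge> 3 \<longrightarrow>
        C_k_on (N - 3) f {0<..} \<and>
        (\<forall>k\<le>N - 3. \<forall>x>0. (deriv ^^ k) f x \<ge> 0) \<and>
        (\<forall>k\<le>N - 3. convex_on {0<..} ((deriv ^^ k) f)) \<and>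
        (\<exists>L R. (\<forall>x>0. ((deriv ^^ (N - 3)) f has_real_derivative L x) (at_left x)) \<and>
               (\<forall>x>0. ((deriv ^^ (N - 3)) f has_real_derivative R x) (at_right x)) \<and>
               mono_on {0<..} L \<and> mono_on {0<..} R))
     \<and>
     (times_differentiable_on (2 * N - 2) f {0<..} \<and>
      (\<forall>A :: real mat.
         map_mat complex_of_real A \<in> psd_mats N (complex_of_real ` {0<..}) \<longrightarrow>
         map_mat complex_of_real (diamond_deriv f N A) \<in> psd_mats N UNIV)
      \<longrightarrow> (\<forall>k\<le>N - 1. \<forall>x>0. (deriv ^^ k) f x \<ge> 0))
     \<and>
     (\<forall>(\<rho> :: ereal) J. 0 < \<rho> \<and> J = {x :: real. 0 < x \<and> ereal x < \<rho>} \<and>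
      times_differentiable_on (2 * N - 2) f J \<and>
      (\<forall>A :: real mat.
         map_mat complex_of_real A \<in> psd_mats N (complex_of_real ` J) \<longrightarrow>
         map_mat complex_of_real (diamond_deriv f N A) \<in> psd_mats N UNIV)
      \<longrightarrow> (\<forall>k\<le>N - 1. \<forall>x\<in>J. (deriv ^^ k) f x \<ge> 0))"
proof (intro conjI impI allI ballI; (elim conjE)?)
  assume psd: "\<forall>A :: real mat. \<forall>h>0.
      map_mat complex_of_real A \<in> psd_mats N (complex_of_real ` {0<..}) \<longrightarrow>
      map_mat complex_of_real (diamond_h f N h A) \<in> psd_mats N UNIV" and N: "N \<ge> 3"
  have diffs: "nonneg_fwd_upto (N - 1) f"
    unfolding nonneg_fwd_upto_def
  proof (intro allI impI)
    fix k h x assume k: "k \<le> N - 1" and h: "(0::real) < h" and x: "(0::real) < x"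
    have "0 \<le> fdiff h k f x"
      using psd N k h x
      by (intro diamond_psd_imp_nonneg[where D = "\<lambda>l. fdiff h l f" and f = f and J = "{0<..}" and N = N])
         (auto simp: diamond_h_def fdiff_eq_fwd)
    then show "0 \<le> (fwd h ^^ k) f x"
      using zero_less_power[OF h, of k] by (simp add: fdiff_eq_fwd zero_le_divide_iff)
  qed
  \<comment> \<open>At \<open>k = N - 3\<close> exactly order 2 remains, which gives convexity,
    hence continuity and one-sided derivatives.\<close>
  have derivs: "nonneg_fwd_upto (N - 1 - k) ((deriv ^^ k) f)" if "k \<le> N - 3" for k
    using that N by (intro nonneg_fwd_upto_higher_deriv[OF diffs]) auto
  show cvx: "convex_on {0<..} ((deriv ^^ k) f)" if "k \<le> N - 3" for k
    using that N by (intro nonneg_fwd_upto_convex_on[OF derivs]) auto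
  show "0 \<le> (deriv ^^ k) f x" if "k \<le> N - 3" "x > 0" for k x
    using nonneg_fwd_uptoD[OF derivs, of k 0 1 x] that by simp
  show "C_k_on (N - 3) f {0<..}"
    unfolding C_k_on_def times_differentiable_on_def
  proof (intro conjI allI impI ballI)
    show "(deriv ^^ k) f differentiable at x" if "k < N - 3" "x \<in> {0<..}" for k x
    proof -
      \<comment> \<open>Below \<open>N - 3\<close> third differences are still available, so kinks
        are excluded.\<close>
      have "3 \<le> N - 1 - k" using that by linarith
      then show ?thesis
        using nonneg_fwd_upto_has_derivative[OF derivs, of k x] that
        by (auto simp: real_differentiable_def)
    qed
    show "continuous_on {0<..} ((deriv ^^ (N - 3)) f)"
      by (intro convex_on_continuous cvx) auto
  qed
  let ?g = "(deriv ^^ (N - 3)) f"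
  show "\<exists>L R. (\<forall>x>0. (?g has_real_derivative L x) (at_left x)) \<and>
        (\<forall>x>0. (?g has_real_derivative R x) (at_right x)) \<and> mono_on {0<..} L \<and> mono_on {0<..} R"
    using has_left_deriv[OF cvx] has_right_deriv[OF cvx] mono_on_left_deriv[OF cvx]
      mono_on_right_deriv[OF cvx]
    by (intro exI[of _ "left_deriv 0 ?g"] exI[of _ "right_deriv ?g"]) auto
next
  fix k :: nat and x :: real
  assume "k \<le> N - 1" "x > 0" "\<forall>A :: real mat.
         map_mat complex_of_real A \<in> psd_mats N (complex_of_real ` {0<..}) \<longrightarrow>
         map_mat complex_of_real (diamond_deriv f N A) \<in> psd_mats N UNIV"
  then show "0 \<le> (deriv ^^ k) f x"
    using assms
    by (intro diamond_psd_imp_nonneg[where D = "\<lambda>l. (deriv ^^ l) f" and f = f and J = "{0<..}" and N = N])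
       (auto simp: diamond_deriv_def)
next
  fix \<rho> :: ereal and J k x
  assume J: "J = {x :: real. 0 < x \<and> ereal x < \<rho>}" and "k \<le> N - 1" "x \<in> J" "\<forall>A :: real mat.
         map_mat complex_of_real A \<in> psd_mats N (complex_of_real ` J) \<longrightarrow>
         map_mat complex_of_real (diamond_deriv f N A) \<in> psd_mats N UNIV"
  \<comment> \<open>The test matrices for \<open>x\<close> have entries in \<open>{0<..x}\<close>
    only.\<close>
  moreover from this have "{0<..x} \<subseteq> J"
    by (auto intro: le_less_trans[of "ereal _" "ereal x"])
  ultimately show "0 \<le> (deriv ^^ k) f x"
    using assms
    by (intro diamond_psd_imp_nonneg[where D = "\<lambda>l. (deriv ^^ l) f" and f = f and J = J and N = N])
       (auto simp: diamond_deriv_def)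
qed

end
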